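(* Let $a\in\mathbb Z^n_{>0}$ and let $f$ be a TP-function on $B(a)$. Then $f$ is skew-submodular if and only if its restriction to $Int(a)$ is skew-submodular, meaning that $f(x+1_i+1_j)+f(x+1_j)\ge f(x+1_i)+f(x+2\cdot1_j)$ holds whenever $i\ne j$ and the four vectors in it belong to $Int(a)$. Furthermore, a skew-submodular TP-function $f$ satisfies $f(x+1_i+1_j)+f(x+1_j+1_k)\ge f(x+1_i+1_k)+f(x+2\cdot1_j)$ for all pairwise distinct $i,j,k$ and all $x$ such that the four vectors involved lie in $B(a)$.
   Context: $B(a)=\{x\in\mathbb Z^n:0\le x\le a\}$; $1_q$ the $q$-th unit vector. A function $f$ on $B(a)$ is skew-submodular if $f(x+1_i+1_j)+f(x+1_j)\ge f(x+1_i)+f(x+2\cdot 1_j)$ for all $x$ and $i\ne j$ (not necessarily ordered) such that all four vectors lie in $B(a)$. A TP-function on $B(a)$: $f$ with $f(x+1_i+1_k)+f(x+1_j)=\max\{f(x+1_i+1_j)+f(x+1_k),f(x+1_i)+f(x+1_j+1_k)\}$ for all $x$, $i<j<k$ with six vectors in $B(a)$, and $f(x+1_i+1_k)+f(x+1_j+1_\ell)=\max\{f(x+1_i+1_j)+f(x+1_k+1_\ell),f(x+1_i+1_\ell)+f(x+1_j+1_k)\}$ for all $x$, $i<j<k<\ell$ with six vectors in $B(a)$. For nonzero $x\in B(a)$ with least and greatest support elements $c(x),d(x)$, $x$ is a fuzzy-interval if $x_i=a_i$ for $c(x)<i<d(x)$; $Int(a)$ is the set of fuzzy-intervals plus the zero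 vector. *)

theory Defs
  imports Complex_Main "HOL-Library.Function_Algebras"
begin

text \<open>
  A vector of \<open>\<int>\<^sup>n\<close> is a function \<open>nat \<Rightarrow> int\<close> with coordinates indexed by \<open>{1..n}\<close> and
  value 0 at all other indices. Addition, numerals (constant functions) and the order are the
  pointwise ones, so \<open>2 * unit_vec j\<close> is twice the \<open>j\<close>-th unit vector.
\<close>

definition int_vecs :: "nat \<Rightarrow> (nat \<Rightarrow> int) set" where
  "int_vecs n = {x. \<forall>i. i \<notin> {1..n} \<longrightarrow> x i = 0}"

definition unit_vec :: "nat \<Rightarrow> (nat \<Rightarrow> int)" where
  "unit_vec q = (\<lambda>i. if i = q then 1 else 0)"

definition box :: "nat \<Rightarrow> (nat \<Rightarrow> int) \<Rightarrow> (nat \<Rightarrow> int) set" where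
  "box n a = {x \<in> int_vecs n. 0 \<le> x \<and> x \<le> a}"

text \<open>
  A function on a set of vectors is a total function of which only the values on that set are
  ever used.
\<close>

definition skew_submodular_on ::
  "nat \<Rightarrow> (nat \<Rightarrow> int) set \<Rightarrow> ((nat \<Rightarrow> int) \<Rightarrow> real) \<Rightarrow> bool" where
  "skew_submodular_on n S f \<longleftrightarrow>
    (\<forall>x \<in> int_vecs n. \<forall>i \<in> {1..n}. \<forall>j \<in> {1..n}. i \<noteq> j \<longrightarrow>
      {x + unit_vec i + unit_vec j, x + unit_vec j,
       x + unit_vec i, x + 2 * unit_vec j} \<subseteq> S \<longrightarrow>
      f (x + unit_vec i + unit_vec j) + f (x + unit_vec j)
        \<ge> f (x + unit_vec i) + f (x + 2 * unit_vec j))"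

definition TP_function :: "nat \<Rightarrow> (nat \<Rightarrow> int) \<Rightarrow> ((nat \<Rightarrow> int) \<Rightarrow> real) \<Rightarrow> bool" where
  "TP_function n a f \<longleftrightarrow>
    (\<forall>x \<in> int_vecs n. \<forall>i \<in> {1..n}. \<forall>j \<in> {1..n}. \<forall>k \<in> {1..n}. i < j \<and> j < k \<longrightarrow>
      {x + unit_vec i + unit_vec k, x + unit_vec j,
       x + unit_vec i + unit_vec j, x + unit_vec k,
       x + unit_vec i, x + unit_vec j + unit_vec k} \<subseteq> box n a \<longrightarrow>
      f (x + unit_vec i + unit_vec k) + f (x + unit_vec j) =
        max (f (x + unit_vec i + unit_vec j) + f (x + unit_vec k))
            (f (x + unit_vec i) + f (x + unit_vec j + unit_vec k))) \<and>
    (\<forall>x \<in> int_vecs n. \<forall>i \<in> {1..n}. \<forall>j \<in> {1..n}. \<forall>k \<in> {1..n}. \<forall>l \<in> {1..n}.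
      i < j \<and> j < k \<and> k < l \<longrightarrow>
      {x + unit_vec i + unit_vec k, x + unit_vec j + unit_vec l,
       x + unit_vec i + unit_vec j, x + unit_vec k + unit_vec l,
       x + unit_vec i + unit_vec l, x + unit_vec j + unit_vec k} \<subseteq> box n a \<longrightarrow>
      f (x + unit_vec i + unit_vec k) + f (x + unit_vec j + unit_vec l) =
        max (f (x + unit_vec i + unit_vec j) + f (x + unit_vec k + unit_vec l))
            (f (x + unit_vec i + unit_vec l) + f (x + unit_vec j + unit_vec k)))"

definition supp :: "(nat \<Rightarrow> int) \<Rightarrow> nat set" where
  "supp x = {i. x i \<noteq> 0}"

definition fuzzy_interval :: "nat \<Rightarrow> (nat \<Rightarrow> int) \<Rightarrow> (nat \<Rightarrow> int) \<Rightarrow> bool" where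
  "fuzzy_interval n a x \<longleftrightarrow>
    x \<in> box n a \<and> x \<noteq> 0 \<and> (\<forall>i. Min (supp x) < i \<and> i < Max (supp x) \<longrightarrow> x i = a i)"

definition fuzzy_intervals :: "nat \<Rightarrow> (nat \<Rightarrow> int) \<Rightarrow> (nat \<Rightarrow> int) set" where
  "fuzzy_intervals n a = {x. fuzzy_interval n a x} \<union> {0}"

end

theory Submission imports Defs begin

text \<open>
  Write \<open>S(x; i, j)\<close> for the skew-submodular inequality at \<open>x\<close>. The three-term TP relations
  yield three propagation rules:
  \<^item> if \<open>k\<close> lies strictly between \<open>i\<close> and \<open>j\<close> and \<open>x\<^sub>k < a\<^sub>k\<close>, then \<open>S(x; k, j)\<close> implies \<open>S(x; i, j)\<close>;
  \<^item> if \<open>j\<close> lies between \<open>i\<close> and \<open>k\<close>, then \<open>S(x; i, j)\<close> and \<open>S(x; k, j)\<close> imply \<open>S(x + 1\<^sub>k; i, j)\<close>;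
  \<^item> if \<open>i\<close> lies between \<open>k\<close> and \<open>j\<close>, then \<open>S(x; i, j)\<close> and \<open>S(x + 1\<^sub>i; k, j)\<close> imply
    \<open>S(x + 1\<^sub>k; i, j)\<close>.

  Every premise is smaller than the conclusion in the lexicographic order of
  \<open>\<Sum>\<^sub>m x\<^sub>m (\<bar>m - j\<bar> + 1)\<close> and \<open>\<bar>i - j\<bar>\<close>. If no rule applies to \<open>S(x; i, j)\<close>, then \<open>x\<close> is full
  strictly between \<open>i\<close> and \<open>j\<close> and zero outside, so all four vectors of \<open>S(x; i, j)\<close> are
  fuzzy-intervals.
\<close>

section \<open>Betweenness, the pointwise inequality and the induction weight\<close>

definition between :: "nat \<Rightarrow> nat \<Rightarrow> nat \<Rightarrow> bool" where
  "between i j k \<longleftrightarrow> i < j \<and> j < k \<or> k < j \<and> j < i"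

definition skew_at :: "((nat \<Rightarrow> int) \<Rightarrow> real) \<Rightarrow> (nat \<Rightarrow> int) \<Rightarrow> nat \<Rightarrow> nat \<Rightarrow> bool" where
  "skew_at f x i j \<longleftrightarrow>
    f (x + unit_vec i) + f (x + 2 * unit_vec j)
      \<le> f (x + unit_vec i + unit_vec j) + f (x + unit_vec j)"

text \<open>The distance factor makes the sum drop also when a unit is moved closer to
  \<open>j\<close>, as the third rule requires.\<close>

definition weight :: "nat \<Rightarrow> nat \<Rightarrow> (nat \<Rightarrow> int) \<Rightarrow> int" where
  "weight n j x = (\<Sum>m = 1..n. x m * (\<bar>int m - int j\<bar> + 1))"

lemma two_unit_vec: "2 * unit_vec j = unit_vec j + unit_vec j"
  by (rule mult_2)

lemma two_unit_vec_apply [simp]: "(2 * unit_vec j) m = (if m = j then 2 else 0)"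
  by (simp add: two_unit_vec unit_vec_def)

lemma weight_add_unit_vec:
  assumes "k \<in> {1..n}"
  shows "weight n j (x + unit_vec k) = weight n j x + \<bar>int k - int j\<bar> + 1"
proof -
  have "weight n j (x + unit_vec k)
      = weight n j x + (\<Sum>m = 1..n. if m = k then \<bar>int m - int j\<bar> + 1 else 0)"
    unfolding weight_def sum.distrib [symmetric]
    by (rule sum.cong) (auto simp: unit_vec_def algebra_simps)
  then show ?thesis
    using assms by simp
qed

lemma weight_nonneg: "0 \<le> x \<Longrightarrow> 0 \<le> weight n j x"
  by (auto simp: weight_def le_fun_def intro!: sum_nonneg)

text \<open>Only \<open>supp z \<subseteq> {p..q}\<close> matters: \<open>p\<close> and
  \<open>q\<close> need not be the ends of the support, so \<open>z\<close> may vanish at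
  either.\<close>

lemma fuzzy_intervalsI:
  assumes "z \<in> box n a"
    and "\<And>m. m < p \<or> q < m \<Longrightarrow> z m = 0"
    and "\<And>m. p < m \<Longrightarrow> m < q \<Longrightarrow> z m = a m"
  shows "z \<in> fuzzy_intervals n a"
proof (cases "z = 0")
  case False
  have sub: "supp z \<subseteq> {p..q}"
    using assms(2) by (fastforce simp: supp_def not_le [symmetric])
  moreover have ne: "supp z \<noteq> {}"
    using False by (auto simp: supp_def fun_eq_iff)
  moreover have fin: "finite (supp z)"
    using sub finite_subset by blast
  ultimately have "p \<le> Min (supp z)" "Max (supp z) \<le> q"
    by auto
  then show ?thesis
    using False assms(1,3) by (auto simp: fuzzy_intervals_def fuzzy_interval_def)
qed (simp add: fuzzy_intervals_def)

section \<open>Membership in the box as coordinatewise bounds\<close>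

context
  fixes n :: nat and a :: "nat \<Rightarrow> int"
  assumes a: "a \<in> int_vecs n"
begin

text \<open>Since \<open>a\<close> vanishes off \<open>{1..n}\<close>, the bounds alone force
  \<open>z\<close> to vanish there.\<close>

lemma mem_box_iff: "z \<in> box n a \<longleftrightarrow> (\<forall>m. 0 \<le> z m \<and> z m \<le> a m)"
proof
  assume *: "\<forall>m. 0 \<le> z m \<and> z m \<le> a m"
  then have "z m = 0" if "m \<notin> {1..n}" for m
    using a that by (metis (mono_tags, lifting) int_vecs_def mem_Collect_eq order_antisym)
  with * show "z \<in> box n a"
    by (simp add: box_def int_vecs_def le_fun_def)
qed (auto simp: box_def le_fun_def)

lemma boxD: "z \<in> box n a \<Longrightarrow> 0 \<le> z m \<and> z m \<le> a m"
  by (simp add: mem_box_iff)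

text \<open>Spares later lemmas the index ranges: room at \<open>i\<close> means
  \<open>0 < a i\<close>.\<close>

lemma box_index: "x \<in> box n a \<Longrightarrow> x i < a i \<Longrightarrow> i \<in> {1..n}"
  using a boxD [of x i] unfolding int_vecs_def by fastforce

lemma fuzzy_intervals_subset_box:
  assumes "\<forall>i \<in> {1..n}. 0 < a i"
  shows "fuzzy_intervals n a \<subseteq> box n a"
proof -
  have "0 \<le> a m" for m
    using a assms by (cases "m \<in> {1..n}") (auto simp: int_vecs_def order.strict_implies_order)
  then show ?thesis
    by (auto simp: fuzzy_intervals_def fuzzy_interval_def mem_box_iff)
qed

lemma skew_vectors_in_box_iff:
  assumes "i \<noteq> j"
  shows "{x + unit_vec i + unit_vec j, x + unit_vec j, x + unit_vec i, x + 2 * unit_vec j}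
      \<subseteq> box n a \<longleftrightarrow> x \<in> box n a \<and> x i < a i \<and> x j + 2 \<le> a j" (is "?L \<longleftrightarrow> ?R")
proof
  assume L: ?L
  \<comment> \<open>As \<open>i \<noteq> j\<close>, every coordinate of \<open>x\<close> is
    unchanged in one of the first two vectors.\<close>
  have "0 \<le> (x + unit_vec i) m" "0 \<le> (x + unit_vec j) m"
    "(x + unit_vec i) m \<le> a m" "(x + 2 * unit_vec j) m \<le> a m" for m
    using L boxD by blast+
  note bounds = this [unfolded plus_fun_apply unit_vec_def two_unit_vec]
  have "0 \<le> x m \<and> x m \<le> a m" for m
    using bounds [of m] assms by (auto split: if_splits)
  moreover have "x i < a i" "x j + 2 \<le> a j"
    using bounds(3) [of i] bounds(4) [of j] by auto
  ultimately show ?R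
    by (simp add: mem_box_iff)
next
  assume ?R
  then show ?L
    using assms by (auto simp: mem_box_iff unit_vec_def)
qed

lemma skew_submodular_on_box_iff:
  "skew_submodular_on n (box n a) f \<longleftrightarrow>
    (\<forall>x \<in> box n a. \<forall>i j. i \<noteq> j \<and> x i < a i \<and> x j + 2 \<le> a j \<longrightarrow> skew_at f x i j)"
  (is "?L \<longleftrightarrow> ?R")
proof
  assume L: ?L
  show ?R
  proof (intro ballI allI impI)
    fix x i j
    assume x: "x \<in> box n a" and ij: "i \<noteq> j \<and> x i < a i \<and> x j + 2 \<le> a j"
    have "x \<in> int_vecs n" "i \<in> {1..n}" "j \<in> {1..n}"
      using x ij box_index [OF x] by (auto simp: box_def)
    moreover have "{x + unit_vec i + unit_vec j, x + unit_vec j, x + unit_vec i,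
        x + 2 * unit_vec j} \<subseteq> box n a"
      using x ij skew_vectors_in_box_iff by blast
    ultimately show "skew_at f x i j"
      using L ij unfolding skew_submodular_on_def skew_at_def by blast
  qed
next
  assume ?R
  then show ?L
    unfolding skew_submodular_on_def skew_at_def [symmetric]
    by (simp add: skew_vectors_in_box_iff del: insert_subset)
qed

section \<open>Consequences of the three-term TP relation\<close>

context
  fixes f :: "(nat \<Rightarrow> int) \<Rightarrow> real"
  assumes TP: "TP_function n a f"
begin

text \<open>Exchanging \<open>i\<close> and \<open>k\<close> merely swaps the arguments of
  \<open>max\<close>, so both orders are covered at once.\<close>

lemma TP_three_term:
  assumes x: "x \<in> box n a" and "between i j k" and lt: "x i < a i" "x j < a j" "x k < a k"
  shows "f (x + unit_vec i + unit_vec k) + f (x + unit_vec j) =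
    max (f (x + unit_vec i + unit_vec j) + f (x + unit_vec k))
        (f (x + unit_vec i) + f (x + unit_vec j + unit_vec k))"
proof -
  have ordered: "f (x + unit_vec i + unit_vec k) + f (x + unit_vec j) =
    max (f (x + unit_vec i + unit_vec j) + f (x + unit_vec k))
        (f (x + unit_vec i) + f (x + unit_vec j + unit_vec k))"
    if lt: "x i < a i" "x j < a j" "x k < a k" and less: "i < j" "j < k" for i j k
  proof -
    have "{x + unit_vec i + unit_vec k, x + unit_vec j, x + unit_vec i + unit_vec j,
        x + unit_vec k, x + unit_vec i, x + unit_vec j + unit_vec k} \<subseteq> box n a"
      using x lt less by (auto simp: mem_box_iff unit_vec_def)
    moreover have "x \<in> int_vecs n" "i \<in> {1..n}" "j \<in> {1..n}" "k \<in> {1..n}"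
      using x box_index [OF x] lt by (auto simp: box_def)
    ultimately show ?thesis
      using TP less unfolding TP_function_def by blast
  qed
  show ?thesis
    using assms(2) unfolding between_def
  proof
    assume "k < j \<and> j < i"
    with ordered [of k j i] lt show ?thesis
      by (simp add: ac_simps)
  qed (use ordered lt in blast)
qed

text \<open>Bound the maximum at \<open>x\<close> below by
  \<open>f (x + unit_vec j) + f (x + unit_vec i + unit_vec k)\<close> and add
  \<open>S\<close>.\<close>

lemma skew_triple_outer:
  assumes x: "x \<in> box n a" and b: "between j i k"
    and lt: "x i < a i" "x j + 2 \<le> a j" "x k < a k"
    and S: "skew_at f x i j"
  shows "f (x + unit_vec i + unit_vec k) + f (x + 2 * unit_vec j)
    \<le> f (x + unit_vec i + unit_vec j) + f (x + unit_vec j + unit_vec k)"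
  using TP_three_term [OF x b] lt S unfolding skew_at_def by (simp add: ac_simps)

text \<open>Whichever argument attains the maximum, one of the two skew inequalities finishes: that
  for \<open>k\<close> if the first does, that for \<open>i\<close> if the second does.\<close>

lemma skew_triple_middle:
  assumes x: "x \<in> box n a" and b: "between i j k"
    and lt: "x i < a i" "x j + 2 \<le> a j" "x k < a k"
    and S: "skew_at f x i j" "skew_at f x k j"
  shows "f (x + unit_vec i + unit_vec k) + f (x + 2 * unit_vec j)
    \<le> f (x + unit_vec i + unit_vec j) + f (x + unit_vec j + unit_vec k)"
  using TP_three_term [OF x b] lt S unfolding skew_at_def
  by (simp add: ac_simps max_def split: if_splits)

text \<open>Bound the maximum below by
  \<open>f (x + unit_vec i) + f (x + unit_vec k + unit_vec j)\<close> and add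
  \<open>S\<close>.\<close>

lemma skew_at_closer:
  assumes x: "x \<in> box n a" and b: "between i k j"
    and lt: "x i < a i" "x j + 2 \<le> a j" "x k < a k"
    and S: "skew_at f x k j"
  shows "skew_at f x i j"
  using TP_three_term [OF x b] lt S unfolding skew_at_def by (simp add: ac_simps)

text \<open>Add the triple inequality at \<open>x\<close> to a lower bound from the TP relation at
  \<open>x + unit_vec j\<close>; \<open>x j + 2 \<le> a j\<close> leaves room for the
  latter.\<close>

lemma skew_at_add_beyond_second:
  assumes x: "x \<in> box n a" and b: "between i j k"
    and lt: "x i < a i" "x j + 2 \<le> a j" "x k < a k"
    and S: "skew_at f x i j" "skew_at f x k j"
  shows "skew_at f (x + unit_vec k) i j"
proof -
  have "x + unit_vec j \<in> box n a"
    using x lt by (auto simp: mem_box_iff unit_vec_def)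
  from TP_three_term [OF this b]
  show ?thesis
    using skew_triple_middle [OF assms] lt b
    unfolding skew_at_def two_unit_vec between_def by (auto simp: ac_simps unit_vec_def)
qed

lemma skew_at_add_beyond_first:
  assumes x: "x \<in> box n a" and b: "between k i j"
    and lt: "x i < a i" "x j + 2 \<le> a j" "x k < a k"
    and S: "skew_at f x i j" "skew_at f (x + unit_vec i) k j"
  shows "skew_at f (x + unit_vec k) i j"
proof -
  have "x + unit_vec j \<in> box n a"
    using x lt by (auto simp: mem_box_iff unit_vec_def)
  moreover have b': "between j i k"
    using b by (auto simp: between_def)
  ultimately have "f (x + unit_vec j + unit_vec j + unit_vec k) + f (x + unit_vec j + unit_vec i) =
    max (f (x + unit_vec j + unit_vec j + unit_vec i) + f (x + unit_vec j + unit_vec k))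
        (f (x + unit_vec j + unit_vec j) + f (x + unit_vec j + unit_vec i + unit_vec k))"
    using lt by (intro TP_three_term) (auto simp: unit_vec_def between_def)
  \<comment> \<open>If the first argument of \<open>max\<close> attains it, \<open>S(2)\<close>
    gives the claim; otherwise the triple inequality does.\<close>
  then show ?thesis
    using skew_triple_outer [OF x b' lt S(1)] S(2)
    unfolding skew_at_def two_unit_vec
    by (simp add: ac_simps max_def split: if_splits)
qed

section \<open>Induction from fuzzy-intervals to the whole box\<close>

lemma skew_at_if_skew_on_fuzzy_intervals:
  assumes skew: "skew_submodular_on n (fuzzy_intervals n a) f"
    and "x \<in> box n a" "i \<noteq> j" "x i < a i" "x j + 2 \<le> a j"
  shows "skew_at f x i j"
  using assms(2-)
\<comment> \<open>Every rule keeps \<open>j\<close>, so the measures may depend on it.\<close>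
proof (induction "(x, i)" arbitrary: x i
    rule: wf_induct_rule [OF wf_measures [of
      "[\<lambda>(x, i). nat (weight n j x), \<lambda>(x, i). nat \<bar>int i - int j\<bar>]"]])
  case less: (1 x i)
  note x = \<open>x \<in> box n a\<close> and ij = \<open>i \<noteq> j\<close> and xi = \<open>x i < a i\<close> and xj = \<open>x j + 2 \<le> a j\<close>
  have IH: "skew_at f y l j"
    if "y \<in> box n a" "l \<noteq> j" "y l < a l" "y j + 2 \<le> a j"
      "weight n j y < weight n j x \<or> y = x \<and> \<bar>int l - int j\<bar> < \<bar>int i - int j\<bar>" for y l
  proof -
    \<comment> \<open>Nonnegativity ensures that \<open>nat\<close> preserves the strict
      decrease.\<close>
    have "0 \<le> weight n j y"
      using that(1) by (auto intro: weight_nonneg simp: box_def)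
    then have "((y, l), (x, i)) \<in> measures
        [\<lambda>(x, i). nat (weight n j x), \<lambda>(x, i). nat \<bar>int i - int j\<bar>]"
      using that(5) by auto
    from less(1) [OF this] show ?thesis
      using that by blast
  qed
  consider
    (gap) k where "between i k j" "x k < a k"
    | (outside) k where "x k \<noteq> 0" "between i j k \<or> between k i j"
    | (interval) "\<And>m. between i m j \<Longrightarrow> x m = a m"
        "\<And>m. between i j m \<or> between m i j \<Longrightarrow> x m = 0"
    using x by (metis mem_box_iff order_le_less)
  then show ?case
  proof cases
    case gap
    then have "k \<noteq> j" "\<bar>int k - int j\<bar> < \<bar>int i - int j\<bar>"
      by (auto simp: between_def)
    then have "skew_at f x k j"
      using IH x gap xj by blast
    then show ?thesis
      using skew_at_closer x gap xi xj by blast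
  next
    case outside
    define y where "y = x - unit_vec k"
    have xy: "x = y + unit_vec k"
      by (simp add: y_def)
    have k: "k \<noteq> i" "k \<noteq> j"
      using outside by (auto simp: between_def)
    have xk: "0 < x k" "x k - 1 < a k"
      using boxD [OF x, of k] outside(1) by auto
    have y: "y \<in> box n a"
      using x xk by (auto simp: y_def mem_box_iff unit_vec_def)
    have lt: "y i < a i" "y j + 2 \<le> a j" "y k < a k"
      using xi xj xk k by (auto simp: y_def unit_vec_def)
    have wk: "weight n j x = weight n j y + \<bar>int k - int j\<bar> + 1"
      using weight_add_unit_vec box_index [OF y lt(3)] by (simp add: xy)
    have Si: "skew_at f y i j"
      using IH [OF y ij lt(1,2)] wk by simp
    from outside(2) show ?thesis
    proof
      assume b: "between i j k"
      have "skew_at f y k j"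
        using IH [OF y k(2) lt(3,2)] wk by simp
      then show ?thesis
        using skew_at_add_beyond_second [OF y b lt Si] xy by simp
    next
      assume b: "between k i j"
      \<comment> \<open>This vector is \<open>x\<close> with one unit moved from \<open>k\<close> to
        \<open>i\<close>, hence closer to \<open>j\<close>.\<close>
      have "y + unit_vec i \<in> box n a"
        using y lt by (auto simp: mem_box_iff unit_vec_def)
      moreover have "weight n j (y + unit_vec i) < weight n j x"
        using weight_add_unit_vec [OF box_index [OF y lt(1)]] wk b by (auto simp: between_def)
      ultimately have "skew_at f (y + unit_vec i) k j"
        using k ij lt by (intro IH) (auto simp: unit_vec_def)
      then show ?thesis
        using skew_at_add_beyond_first [OF y b lt Si] xy by simp
    qed
  next
    case interval
    \<comment> \<open>The four vectors differ from \<open>x\<close> only at \<open>i\<close> and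
      \<open>j\<close>, where a fuzzy-interval with these outer bounds is unconstrained within the
      box.\<close>
    have fuzzy: "z \<in> fuzzy_intervals n a"
      if z: "z \<in> box n a" and eq: "\<And>m. m \<noteq> i \<Longrightarrow> m \<noteq> j \<Longrightarrow> z m = x m" for z
    proof (rule fuzzy_intervalsI [of _ _ _ "min i j" "max i j"])
      show "z m = 0" if "m < min i j \<or> max i j < m" for m
        using that ij interval(2) [of m] eq [of m]
        by (cases i j rule: linorder_cases) (auto simp: between_def)
      show "z m = a m" if "min i j < m" "m < max i j" for m
        using that ij interval(1) [of m] eq [of m]
        by (cases i j rule: linorder_cases) (auto simp: between_def)
    qed (rule z)
    have "{x + unit_vec i + unit_vec j, x + unit_vec j, x + unit_vec i, x + 2 * unit_vec j}
        \<subseteq> box n a"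
      using x ij xi xj skew_vectors_in_box_iff by blast
    then have "{x + unit_vec i + unit_vec j, x + unit_vec j, x + unit_vec i, x + 2 * unit_vec j}
        \<subseteq> fuzzy_intervals n a"
      by (auto intro!: fuzzy simp: unit_vec_def)
    moreover have "x \<in> int_vecs n" "i \<in> {1..n}" "j \<in> {1..n}"
      using x xi xj box_index [OF x] by (auto simp: box_def)
    ultimately show ?thesis
      using skew ij unfolding skew_submodular_on_def skew_at_def by blast
  qed
qed

section \<open>The inequality for three distinct indices\<close>

lemma skew_triple:
  assumes skew: "skew_submodular_on n (box n a) f"
    and dist: "i \<noteq> j" "j \<noteq> k" "i \<noteq> k"
    and sub: "{x + unit_vec i + unit_vec j, x + unit_vec j + unit_vec k,
             x + unit_vec i + unit_vec k, x + 2 * unit_vec j} \<subseteq> box n a"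
  shows "f (x + unit_vec i + unit_vec k) + f (x + 2 * unit_vec j)
    \<le> f (x + unit_vec i + unit_vec j) + f (x + unit_vec j + unit_vec k)"
proof -
  have "0 \<le> (x + unit_vec i + unit_vec j) m" "0 \<le> (x + unit_vec j + unit_vec k) m"
    "0 \<le> (x + unit_vec i + unit_vec k) m" "(x + unit_vec i + unit_vec k) m \<le> a m"
    "(x + 2 * unit_vec j) m \<le> a m" for m
    using sub boxD by blast+
  note bounds = this [unfolded plus_fun_apply unit_vec_def two_unit_vec]
  have "0 \<le> x m \<and> x m \<le> a m" for m
    using bounds [of m] dist by (auto split: if_splits)
  then have x: "x \<in> box n a"
    by (simp add: mem_box_iff)
  have lt: "x i < a i" "x j + 2 \<le> a j" "x k < a k"
    using bounds(4) [of i] bounds(5) [of j] bounds(4) [of k] dist by auto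
  have S: "skew_at f x i j" "skew_at f x k j"
    using skew x lt dist unfolding skew_submodular_on_box_iff by auto
  \<comment> \<open>The middle index decides; the third case is the second with \<open>i\<close> and
    \<open>k\<close> exchanged.\<close>
  consider "between i j k" | "between j i k" | "between j k i"
    using dist unfolding between_def by linarith
  then show ?thesis
  proof cases
    case 1
    then show ?thesis
      using skew_triple_middle x lt S by blast
  next
    case 2
    then show ?thesis
      using skew_triple_outer x lt S by blast
  next
    case 3
    then show ?thesis
      using skew_triple_outer [OF x 3 lt(3,2,1) S(2)] by (simp add: ac_simps)
  qed
qed

end

end

theorem theorem7p1:
  fixes n :: nat and a :: "nat \<Rightarrow> int" and f :: "(nat \<Rightarrow> int) \<Rightarrow> real"
  assumes "a \<in> int_vecs n"
    and "\<forall>i \<in> {1..n}. 0 < a i"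
    and "TP_function n a f"
  shows "(skew_submodular_on n (box n a) f \<longleftrightarrow>
          skew_submodular_on n (fuzzy_intervals n a) f) \<and>
         (skew_submodular_on n (box n a) f \<longrightarrow>
          (\<forall>x \<in> int_vecs n. \<forall>i \<in> {1..n}. \<forall>j \<in> {1..n}. \<forall>k \<in> {1..n}.
            i \<noteq> j \<and> j \<noteq> k \<and> i \<noteq> k \<longrightarrow>
            {x + unit_vec i + unit_vec j, x + unit_vec j + unit_vec k,
             x + unit_vec i + unit_vec k, x + 2 * unit_vec j} \<subseteq> box n a \<longrightarrow>
            f (x + unit_vec i + unit_vec j) + f (x + unit_vec j + unit_vec k)
              \<ge> f (x + unit_vec i + unit_vec k) + f (x + 2 * unit_vec j)))"
proof -
  have "skew_submodular_on n (box n a) f \<longleftrightarrow> skew_submodular_on n (fuzzy_intervals n a) f"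
  proof
    assume "skew_submodular_on n (box n a) f"
    then show "skew_submodular_on n (fuzzy_intervals n a) f"
      using fuzzy_intervals_subset_box [OF assms(1,2)]
      unfolding skew_submodular_on_def by (meson order_trans)
  next
    assume "skew_submodular_on n (fuzzy_intervals n a) f"
    then show "skew_submodular_on n (box n a) f"
      using skew_at_if_skew_on_fuzzy_intervals [OF assms(1,3)]
      by (auto simp: skew_submodular_on_box_iff [OF assms(1)])
  qed
  then show ?thesis
    using skew_triple [OF assms(1,3)] by blast
qed

end
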